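(* Let $f:\mathbb{R}\to\mathbb{R}$ satisfy: (A1) $f$ is locally Lipschitz continuous and $uf(u)>0$ for all $u\neq 0$; (A2) $f$ is differentiable at $0$ with $f'(0)>0$. Let $c\in\mathbb{R}$ satisfy $0<c^4<4f'(0)$. If $u:\mathbb{R}\to\mathbb{R}$ is a nonzero homoclinic solution of $$u'''' + c^2 u'' + f(u) = 0,$$ then $\|u\|_\infty \geq L(f,c)$, where $$L(f,c) = \sup\left\{\delta>0 : \frac{f(v)}{v} > \frac{c^4}{4} \text{ for all } v\in\mathbb{R} \text{ with } 0\neq |v|<\delta\right\}.$$
   Context: A homoclinic solution of the ODE $u''''+c^2u''+f(u)=0$ is a (classical, four times continuously differentiable) solution $u:\mathbb{R}\to\mathbb{R}$ defined on all of $\mathbb{R}$ with $u(s)\to 0$ as $s\to+\infty$ and as $s\to-\infty$. Nonzero means not identically zero. $\|u\|_\infty=\sup_{s\in\mathbb{R}}|u(s)|$. The set defining $L(f,c)$ is nonempty because $\lim_{v\to 0} f(v)/v=f'(0)>c^4/4$, and the supremum is taken in $(0,\infty]$; if $L(f,c)=\infty$, the conclusion means that no nonzero homoclinic solution exists. *)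

theory Defs
  imports "HOL-Analysis.Analysis"
begin

definition C4_on_reals :: "(real \<Rightarrow> real) \<Rightarrow> bool" where
  "C4_on_reals u \<longleftrightarrow>
     (\<forall>k<4. \<forall>s. (deriv ^^ k) u differentiable (at s)) \<and>
     continuous_on UNIV ((deriv ^^ 4) u)"

definition homoclinic_solution :: "real \<Rightarrow> (real \<Rightarrow> real) \<Rightarrow> (real \<Rightarrow> real) \<Rightarrow> bool" where
  "homoclinic_solution c f u \<longleftrightarrow>
     C4_on_reals u \<and>
     (\<forall>s. (deriv ^^ 4) u s + c^2 * (deriv ^^ 2) u s + f (u s) = 0) \<and>
     (u \<longlongrightarrow> 0) at_top \<and> (u \<longlongrightarrow> 0) at_bot"

(* Extended reals give suprema of unbounded sets their usual value, infinity;
   on type real, Sup is unspecified there. *)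

definition sup_norm :: "(real \<Rightarrow> real) \<Rightarrow> ereal" where
  "sup_norm u = (SUP s. ereal \<bar>u s\<bar>)"

definition L :: "(real \<Rightarrow> real) \<Rightarrow> real \<Rightarrow> ereal" where
  "L f c = Sup (ereal ` {\<delta>. \<delta> > 0 \<and> (\<forall>v. 0 \<noteq> \<bar>v\<bar> \<and> \<bar>v\<bar> < \<delta> \<longrightarrow> f v / v > c^4 / 4)})"

end

theory Submission
  imports Defs
begin

text \<open>Put \<open>\<Phi> = u u''' - u' u''\<close>. Completing the square, the equation gives
  \<open>\<Phi>' = - (u'' + c\<^sup>2 u / 2)\<^sup>2 - (u f(u) - c\<^sup>4 u\<^sup>2 / 4)\<close>.
  If \<open>\<parallel>u\<parallel> < L(f,c)\<close>, this is nonpositive, and negative wherever \<open>u \<noteq> 0\<close>. On the other hand \<open>\<Phi>\<close>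
  vanishes at both ends, because \<open>u \<rightarrow> 0\<close> and the equation force the first three derivatives to
  tend to \<open>0\<close>; hence \<open>\<Phi> = 0\<close> and \<open>u = 0\<close>.
  For the decay of the derivatives, \<open>w = u'' + c\<^sup>2 u\<close> satisfies \<open>w'' = - f(u) \<rightarrow> 0\<close>, so near a large \<open>s\<close>
  the function \<open>u\<close> is almost a cubic polynomial with coefficients \<open>u(s)\<close>, \<open>u'(s)\<close>, \<open>w(s)/2\<close>,
  \<open>w'(s)/6\<close>; since it is small at \<open>s\<close>, \<open>s + 1\<close>, \<open>s + 2\<close>, \<open>s + 3\<close>, so are the coefficients.\<close>

section \<open>Decay of the first three derivatives at both ends\<close>

lemma second_order_Taylor_bound:
  fixes p p1 p2 :: "real \<Rightarrow> real"
  assumes p: "\<And>t. (p has_real_derivative p1 t) (at t)"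
    and p1: "\<And>t. (p1 has_real_derivative p2 t) (at t)"
    and "h > 0"
    and bound: "\<And>t. s \<le> t \<Longrightarrow> t \<le> s + h \<Longrightarrow> \<bar>p2 t\<bar> \<le> K"
  shows "\<bar>p (s + h) - p s - p1 s * h\<bar> \<le> K * h\<^sup>2 / 2"
proof -
  define D where "D = (\<lambda>n::nat. if n = 0 then p else if n = 1 then p1 else p2)"
  have "\<exists>t>s. t < s + h \<and>
      p (s + h) = (\<Sum>m<2. D m s / fact m * ((s + h) - s) ^ m) + D 2 t / fact 2 * ((s + h) - s) ^ 2"
  proof (rule Taylor_up[where a = s])
    show "\<forall>m t. m < 2 \<and> s \<le> t \<and> t \<le> s + h \<longrightarrow> DERIV (D m) t :> D (Suc m) t"
      using p p1 by (auto simp: D_def less_Suc_eq numeral_2_eq_2)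
  qed (use \<open>h > 0\<close> in \<open>auto simp: D_def\<close>)
  then obtain t where t: "s < t" "t < s + h" and
    eq: "p (s + h) = p s + p1 s * h + p2 t / 2 * h\<^sup>2"
    by (auto simp: D_def numeral_2_eq_2)
  have "\<bar>p (s + h) - p s - p1 s * h\<bar> = \<bar>p2 t\<bar> * h\<^sup>2 / 2"
    by (simp add: eq abs_mult)
  also have "\<dots> \<le> K * h\<^sup>2 / 2"
    using bound[of t] t by (intro divide_right_mono mult_right_mono) auto
  finally show ?thesis .
qed

text \<open>The quantitative form of the cubic approximation. The constant \<open>C\<close> depends
  on \<open>k\<close> alone, so smallness of \<open>u\<close> and \<open>g\<close> beyond
  \<open>s\<close> passes linearly to the derivatives at \<open>s\<close>.\<close>

lemma derivative_bounds:
  fixes u u1 u2 u3 g :: "real \<Rightarrow> real"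
  assumes u: "\<And>t. (u has_real_derivative u1 t) (at t)"
    and u1: "\<And>t. (u1 has_real_derivative u2 t) (at t)"
    and u2: "\<And>t. (u2 has_real_derivative u3 t) (at t)"
    and u3: "\<And>t. (u3 has_real_derivative - k * u2 t - g t) (at t)"
    and "k \<ge> 0"
    and small: "\<And>t. t \<ge> s \<Longrightarrow> \<bar>u t\<bar> \<le> \<epsilon>" "\<And>t. t \<ge> s \<Longrightarrow> \<bar>g t\<bar> \<le> \<epsilon>"
  defines "C \<equiv> 20 + 45 * (9 / 2 + k)"
  shows "\<bar>u1 s\<bar> \<le> C * \<epsilon>" "\<bar>u2 s + k * u s\<bar> \<le> C * \<epsilon>" "\<bar>u3 s + k * u1 s\<bar> \<le> C * \<epsilon>"
proof -
  define w w1 where "w = (\<lambda>t. u2 t + k * u t)" and "w1 = (\<lambda>t. u3 t + k * u1 t)"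
  \<comment> \<open>\<open>K\<close> bounds the distance of \<open>u2\<close> from the tangent line
    of \<open>w\<close> at \<open>s\<close>: 9/2 \<epsilon> is the Taylor error of \<open>w\<close>
    over a length of at most 3, and \<open>k * \<epsilon>\<close> bounds \<open>k * u\<close>. In
    \<open>R\<close>, 9/2 \<open>K\<close> is the Taylor error for \<open>u\<close>, and 2
    \<epsilon> accounts for \<open>u s\<close> and \<open>u (s + h)\<close>.\<close>
  define K where "K = (9 / 2 + k) * \<epsilon>"
  define R where "R = 2 * \<epsilon> + 9 / 2 * K"
  have "\<epsilon> \<ge> 0"
    using small(1)[of s] by linarith
  have "K \<ge> 0"
    using \<open>\<epsilon> \<ge> 0\<close> \<open>k \<ge> 0\<close> by (simp add: K_def)
  have w: "(w has_real_derivative w1 t) (at t)" for t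
    unfolding w_def w1_def by (auto intro!: derivative_eq_intros u u2)
  have w1: "(w1 has_real_derivative - g t) (at t)" for t
    unfolding w1_def by (auto intro!: derivative_eq_intros u1 u3)
  have w_near: "\<bar>w t - w s - w1 s * (t - s)\<bar> \<le> 9 / 2 * \<epsilon>" if "s \<le> t" "t \<le> s + 3" for t
  \<comment> \<open>The Taylor bound requires a positive step, so \<open>t = s\<close> is treated
    separately.\<close>
  proof (cases "t = s")
    case False
    then have "\<bar>w (s + (t - s)) - w s - w1 s * (t - s)\<bar> \<le> \<epsilon> * (t - s)\<^sup>2 / 2"
      using that small(2) by (intro second_order_Taylor_bound[OF w w1]) auto
    also have "\<dots> \<le> \<epsilon> * 3\<^sup>2 / 2"
      using that \<open>\<epsilon> \<ge> 0\<close> by (intro divide_right_mono mult_left_mono power_mono) auto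
    finally show ?thesis by simp
  qed (use \<open>\<epsilon> \<ge> 0\<close> in simp)
  have cubic: "\<bar>u1 s * h + w s * h\<^sup>2 / 2 + w1 s * h ^ 3 / 6\<bar> \<le> R" if h: "0 < h" "h \<le> 3" for h
  proof -
    \<comment> \<open>Subtracting the double integral of the tangent line of \<open>w\<close> leaves
      \<open>q\<close> with the same value and slope as \<open>u\<close> at \<open>s\<close>, but
      with a small second derivative.\<close>
    define q q1 q2 where "q = (\<lambda>t. u t - w s * (t - s)\<^sup>2 / 2 - w1 s * (t - s) ^ 3 / 6)"
      and "q1 = (\<lambda>t. u1 t - w s * (t - s) - w1 s * (t - s)\<^sup>2 / 2)"
      and "q2 = (\<lambda>t. u2 t - w s - w1 s * (t - s))"
    have "\<bar>q (s + h) - q s - q1 s * h\<bar> \<le> K * h\<^sup>2 / 2"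
    proof (rule second_order_Taylor_bound)
      show "(q has_real_derivative q1 t) (at t)" for t
        unfolding q_def q1_def by (auto intro!: derivative_eq_intros u simp: power2_eq_square)
      show "(q1 has_real_derivative q2 t) (at t)" for t
        unfolding q1_def q2_def by (auto intro!: derivative_eq_intros u1)
      show "\<bar>q2 t\<bar> \<le> K" if t: "s \<le> t" "t \<le> s + h" for t
      proof -
        have "\<bar>k * u t\<bar> \<le> k * \<epsilon>"
          using small(1)[OF t(1)] \<open>k \<ge> 0\<close> by (simp add: abs_mult mult_left_mono)
        moreover have "q2 t = (w t - w s - w1 s * (t - s)) - k * u t"
          by (simp add: q2_def w_def)
        moreover have "\<bar>w t - w s - w1 s * (t - s)\<bar> \<le> 9 / 2 * \<epsilon>"
          using w_near t h by simp
        moreover have "K = 9 / 2 * \<epsilon> + k * \<epsilon>"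
          by (simp add: K_def algebra_simps)
        ultimately show ?thesis
          by linarith
      qed
    qed (use h in auto)
    also have "\<dots> \<le> K * 3\<^sup>2 / 2"
      using h \<open>K \<ge> 0\<close> by (intro divide_right_mono mult_left_mono power_mono) auto
    finally have "\<bar>u (s + h) - u s - (u1 s * h + w s * h\<^sup>2 / 2 + w1 s * h ^ 3 / 6)\<bar> \<le> 9 / 2 * K"
      by (simp add: q_def q1_def algebra_simps)
    then show ?thesis
      using small(1)[of s] small(1)[of "s + h"] h unfolding R_def by linarith
  qed
  have C: "C * \<epsilon> = 10 * R"
    by (simp add: C_def R_def K_def algebra_simps)
  have at1: "\<bar>u1 s + w s / 2 + w1 s / 6\<bar> \<le> R"
    using cubic[of 1] by simp
  have at2: "\<bar>2 * u1 s + 2 * w s + 4 / 3 * w1 s\<bar> \<le> R"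
    using cubic[of 2] by (simp add: algebra_simps)
  have at3: "\<bar>3 * u1 s + 9 / 2 * w s + 9 / 2 * w1 s\<bar> \<le> R"
    using cubic[of 3] by (simp add: algebra_simps)
  \<comment> \<open>With p1, p2, p3 the cubic at h = 1, 2, 3, inverting the linear system gives
    \<open>w s\<close> = -5 p1 + 4 p2 - p3, whence the factor 10; the coefficients for
    \<open>u1 s\<close> and \<open>w1 s\<close> have smaller absolute sums.\<close>
  have "\<bar>u1 s\<bar> \<le> 10 * R" "\<bar>w s\<bar> \<le> 10 * R" "\<bar>w1 s\<bar> \<le> 10 * R"
    using at1 at2 at3 by linarith+
  then show "\<bar>u1 s\<bar> \<le> C * \<epsilon>" "\<bar>u2 s + k * u s\<bar> \<le> C * \<epsilon>" "\<bar>u3 s + k * u1 s\<bar> \<le> C * \<epsilon>"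
    by (simp_all add: C w_def w1_def)
qed

lemma derivatives_tendsto_0:
  fixes u u1 u2 u3 g :: "real \<Rightarrow> real"
  assumes u: "\<And>t. (u has_real_derivative u1 t) (at t)"
    and u1: "\<And>t. (u1 has_real_derivative u2 t) (at t)"
    and u2: "\<And>t. (u2 has_real_derivative u3 t) (at t)"
    and u3: "\<And>t. (u3 has_real_derivative - k * u2 t - g t) (at t)"
    and "k \<ge> 0"
    and u_lim: "(u \<longlongrightarrow> 0) at_top" and g_lim: "(g \<longlongrightarrow> 0) at_top"
  shows "(u1 \<longlongrightarrow> 0) at_top" "(u2 \<longlongrightarrow> 0) at_top" "(u3 \<longlongrightarrow> 0) at_top"
proof -
  define C where "C = 20 + 45 * (9 / 2 + k)"
  have "C > 0"
    using \<open>k \<ge> 0\<close> by (simp add: C_def)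
  have *: "\<forall>\<^sub>F s in at_top. \<bar>u1 s\<bar> < e \<and> \<bar>u2 s + k * u s\<bar> < e \<and> \<bar>u3 s + k * u1 s\<bar> < e"
    if "e > 0" for e
  proof -
    \<comment> \<open>The factor 2 turns the non-strict bound \<open>C * \<epsilon>\<close> into a
      strict one by \<open>e\<close>.\<close>
    define \<epsilon> where "\<epsilon> = e / (2 * C)"
    have "\<epsilon> > 0" and C\<epsilon>: "C * \<epsilon> < e"
      using \<open>e > 0\<close> \<open>C > 0\<close> by (simp_all add: \<epsilon>_def)
    have "\<forall>\<^sub>F t in at_top. \<bar>u t\<bar> < \<epsilon> \<and> \<bar>g t\<bar> < \<epsilon>"
      using tendstoD[OF u_lim \<open>\<epsilon> > 0\<close>] tendstoD[OF g_lim \<open>\<epsilon> > 0\<close>]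
      by eventually_elim simp
    then obtain S where S: "\<And>t. t \<ge> S \<Longrightarrow> \<bar>u t\<bar> < \<epsilon> \<and> \<bar>g t\<bar> < \<epsilon>"
      by (auto simp: eventually_at_top_linorder)
    show ?thesis
    proof (rule eventually_at_top_linorderI)
      fix s assume "s \<ge> S"
      then have "\<bar>u t\<bar> \<le> \<epsilon>" "\<bar>g t\<bar> \<le> \<epsilon>" if "t \<ge> s" for t
        using S[of t] that by auto
      from derivative_bounds[OF u u1 u2 u3 \<open>k \<ge> 0\<close> this]
      show "\<bar>u1 s\<bar> < e \<and> \<bar>u2 s + k * u s\<bar> < e \<and> \<bar>u3 s + k * u1 s\<bar> < e"
        using C\<epsilon> unfolding C_def by fastforce
    qed
  qed
  show u1_lim: "(u1 \<longlongrightarrow> 0) at_top"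
    by (rule tendstoI, drule *) (auto elim: eventually_mono)
  \<comment> \<open>The bounds control \<open>u2 + k * u\<close> and \<open>u3 + k * u1\<close>;
    removing the lower-order terms uses the limits of \<open>u\<close> and of \<open>u1\<close>, the
    latter just obtained.\<close>
  have "((\<lambda>s. u2 s + k * u s) \<longlongrightarrow> 0) at_top"
    by (rule tendstoI, drule *) (auto elim: eventually_mono)
  from tendsto_diff[OF this tendsto_mult_left[OF u_lim, of k]]
  show "(u2 \<longlongrightarrow> 0) at_top" by simp
  have "((\<lambda>s. u3 s + k * u1 s) \<longlongrightarrow> 0) at_top"
    by (rule tendstoI, drule *) (auto elim: eventually_mono)
  from tendsto_diff[OF this tendsto_mult_left[OF u1_lim, of k]]
  show "(u3 \<longlongrightarrow> 0) at_top" by simp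
qed

text \<open>Time reversal: the equation contains only derivatives of even order, so t \<mapsto> -t
  preserves its form, while \<open>u1\<close> and \<open>u3\<close> change sign.\<close>

lemma derivatives_tendsto_0_at_bot:
  fixes u u1 u2 u3 g :: "real \<Rightarrow> real"
  assumes u: "\<And>t. (u has_real_derivative u1 t) (at t)"
    and u1: "\<And>t. (u1 has_real_derivative u2 t) (at t)"
    and u2: "\<And>t. (u2 has_real_derivative u3 t) (at t)"
    and u3: "\<And>t. (u3 has_real_derivative - k * u2 t - g t) (at t)"
    and "k \<ge> 0"
    and "(u \<longlongrightarrow> 0) at_bot" and "(g \<longlongrightarrow> 0) at_bot"
  shows "(u1 \<longlongrightarrow> 0) at_bot" "(u2 \<longlongrightarrow> 0) at_bot" "(u3 \<longlongrightarrow> 0) at_bot"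
proof -
  have reflect: "((\<lambda>t. p (- t)) has_real_derivative - p' (- t)) (at t)"
    if "\<And>t. (p has_real_derivative p' t) (at t)" for p p' :: "real \<Rightarrow> real" and t
    using DERIV_chain2[OF that DERIV_minus[OF DERIV_ident]] by simp
  have v: "((\<lambda>t. u (- t)) has_real_derivative - u1 (- t)) (at t)" for t
    by (rule reflect[OF u])
  have v1: "((\<lambda>t. - u1 (- t)) has_real_derivative u2 (- t)) (at t)" for t
    using DERIV_minus[OF reflect[OF u1]] by simp
  have v2: "((\<lambda>t. u2 (- t)) has_real_derivative - u3 (- t)) (at t)" for t
    by (rule reflect[OF u2])
  have v3: "((\<lambda>t. - u3 (- t)) has_real_derivative - k * u2 (- t) - g (- t)) (at t)" for t
    using DERIV_minus[OF reflect[OF u3], of t] by (simp only: minus_minus)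
  have "((\<lambda>t. u (- t)) \<longlongrightarrow> 0) at_top" "((\<lambda>t. g (- t)) \<longlongrightarrow> 0) at_top"
    using assms(6,7) by (simp_all add: filterlim_at_bot_mirror)
  note lims = derivatives_tendsto_0[OF v v1 v2 v3 \<open>k \<ge> 0\<close> this]
  show "(u1 \<longlongrightarrow> 0) at_bot" "(u2 \<longlongrightarrow> 0) at_bot" "(u3 \<longlongrightarrow> 0) at_bot"
    using tendsto_minus[OF lims(1)] lims(2) tendsto_minus[OF lims(3)]
    by (simp_all add: filterlim_at_bot_mirror)
qed

section \<open>The monotone quantity \<Phi> and vanishing of small solutions\<close>

lemma antimono_tendsto_same_eq:
  fixes \<phi> :: "real \<Rightarrow> real"
  assumes "antimono \<phi>" and top: "(\<phi> \<longlongrightarrow> l) at_top" and bot: "(\<phi> \<longlongrightarrow> l) at_bot"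
  shows "\<phi> s = l"
proof (rule antisym)
  show "\<phi> s \<le> l"
    by (rule tendsto_lowerbound[OF bot])
      (use \<open>antimono \<phi>\<close> in \<open>auto simp: eventually_at_bot_linorder antimono_def\<close>)
  show "l \<le> \<phi> s"
    by (rule tendsto_upperbound[OF top])
      (use \<open>antimono \<phi>\<close> in \<open>auto simp: eventually_at_top_linorder antimono_def\<close>)
qed

text \<open>\<open>f\<close> is negative to the left of 0 and positive to the right, so its
  one-sided limits squeeze \<open>f 0\<close>. This makes \<open>f (u t)\<close> tend to 0 along
  with \<open>u t\<close>.\<close>

lemma isCont_sign_imp_zero:
  fixes f :: "real \<Rightarrow> real"
  assumes cont: "isCont f 0" and sign: "\<And>v. v \<noteq> 0 \<Longrightarrow> v * f v > 0"
  shows "f 0 = 0"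
proof (rule antisym)
  have f: "(f \<longlongrightarrow> f 0) (at_left 0)" "(f \<longlongrightarrow> f 0) (at_right 0)"
    using cont unfolding isCont_def by (auto simp: filterlim_at_split)
  have "f v \<le> 0" if "v < 0" for v
    using sign[of v] that by (simp add: zero_less_mult_iff)
  then show "f 0 \<le> 0"
    by (intro tendsto_upperbound[OF f(1)]) (auto simp: eventually_at_filter)
  have "f v \<ge> 0" if "v > 0" for v
    using sign[of v] that by (simp add: zero_less_mult_iff)
  then show "0 \<le> f 0"
    by (intro tendsto_lowerbound[OF f(2)]) (auto simp: eventually_at_filter)
qed

lemma homoclinic_eq_0:
  fixes u u1 u2 u3 f :: "real \<Rightarrow> real"
  assumes u: "\<And>t. (u has_real_derivative u1 t) (at t)"
    and u1: "\<And>t. (u1 has_real_derivative u2 t) (at t)"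
    and u2: "\<And>t. (u2 has_real_derivative u3 t) (at t)"
    and u3: "\<And>t. (u3 has_real_derivative - c\<^sup>2 * u2 t - f (u t)) (at t)"
    and u_top: "(u \<longlongrightarrow> 0) at_top" and u_bot: "(u \<longlongrightarrow> 0) at_bot"
    and "isCont f 0" "f 0 = 0"
    and ratio: "\<And>t. u t \<noteq> 0 \<Longrightarrow> f (u t) / u t > c ^ 4 / 4"
  shows "u s = 0"
proof (rule ccontr)
  assume "u s \<noteq> 0"
  define \<Phi> \<Phi>' where "\<Phi> = (\<lambda>t. u t * u3 t - u1 t * u2 t)"
    and "\<Phi>' = (\<lambda>t. - (u2 t + c\<^sup>2 / 2 * u t)\<^sup>2 - (u t * f (u t) - c ^ 4 / 4 * (u t)\<^sup>2))"
  \<comment> \<open>The products \<open>u1 t * u3 t\<close> cancel; inserting the equation into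
    \<open>u t\<close> times the fourth derivative and completing the square gives \<Phi>'.\<close>
  have \<Phi>: "(\<Phi> has_real_derivative \<Phi>' t) (at t)" for t
    unfolding \<Phi>_def \<Phi>'_def
    by (auto intro!: derivative_eq_intros u u1 u2 u3
        simp: power2_eq_square power4_eq_xxxx algebra_simps)
  have pos: "u t * f (u t) - c ^ 4 / 4 * (u t)\<^sup>2 > 0" if "u t \<noteq> 0" for t
  proof -
    have "u t * f (u t) = f (u t) / u t * (u t)\<^sup>2"
      using that by (simp add: power2_eq_square)
    moreover have "c ^ 4 / 4 * (u t)\<^sup>2 < f (u t) / u t * (u t)\<^sup>2"
      using ratio[OF that] that by (intro mult_strict_right_mono) auto
    ultimately show ?thesis by linarith
  qed
  have "\<Phi>' t \<le> 0" for t
  proof -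
    have "u t * f (u t) - c ^ 4 / 4 * (u t)\<^sup>2 \<ge> 0"
      using pos[of t] by (cases "u t = 0") auto
    moreover have "(u2 t + c\<^sup>2 / 2 * u t)\<^sup>2 \<ge> 0"
      by simp
    ultimately show ?thesis
      unfolding \<Phi>'_def by linarith
  qed
  then have anti: "antimono \<Phi>"
    using \<Phi> by (auto intro!: antimonoI intro: DERIV_nonpos_imp_nonincreasing)
  \<comment> \<open>The filter is left arbitrary to serve both ends; the decay lemmas are then
    applied with \<open>k\<close> equal to the square of \<open>c\<close> and \<open>g\<close> equal
    to \<open>f\<close> composed with \<open>u\<close>.\<close>
  have f_lim: "((\<lambda>t. f (u t)) \<longlongrightarrow> 0) F" if "(u \<longlongrightarrow> 0) F" for F
    using isCont_tendsto_compose[OF \<open>isCont f 0\<close> that] \<open>f 0 = 0\<close> by simp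
  note top = derivatives_tendsto_0[OF u u1 u2 u3 zero_le_power2 u_top f_lim[OF u_top]]
  note bot = derivatives_tendsto_0_at_bot[OF u u1 u2 u3 zero_le_power2 u_bot f_lim[OF u_bot]]
  have "(\<Phi> \<longlongrightarrow> 0) at_top"
    unfolding \<Phi>_def by (rule tendsto_eq_intros u_top top refl | simp)+
  moreover have "(\<Phi> \<longlongrightarrow> 0) at_bot"
    unfolding \<Phi>_def by (rule tendsto_eq_intros u_bot bot refl | simp)+
  ultimately have "\<Phi> = (\<lambda>_. 0)"
    using antimono_tendsto_same_eq[OF anti] by blast
  \<comment> \<open>A constant \<Phi> has zero derivative at \<open>s\<close>, whereas
    \<open>pos\<close> makes \<Phi>' strictly negative there.\<close>
  then have "\<Phi>' s = 0"
    using DERIV_unique[OF \<Phi>[of s], of 0] by simp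
  moreover have "(u2 s + c\<^sup>2 / 2 * u s)\<^sup>2 \<ge> 0"
    by simp
  ultimately show False
    using pos[OF \<open>u s \<noteq> 0\<close>] unfolding \<Phi>'_def by linarith
qed

section \<open>The lower bound for the sup norm\<close>

theorem theorem1:
  fixes f u :: "real \<Rightarrow> real" and c :: real
  assumes "local_lipschitz (UNIV :: real set) UNIV (\<lambda>_. f)"
    and "\<And>v. v \<noteq> 0 \<Longrightarrow> v * f v > 0"
    and "f differentiable (at 0)"
    and "deriv f 0 > 0"
    and "0 < c^4"
    and "c^4 < 4 * deriv f 0"
    and "homoclinic_solution c f u"
    and "\<exists>s. u s \<noteq> 0"
  shows "sup_norm u \<ge> L f c"
proof (rule ccontr)
  assume "\<not> sup_norm u \<ge> L f c"
  \<comment> \<open>A strict inequality below a supremum is witnessed by a member of the set, so a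
    real admissible \<delta> exceeds the norm even when \<open>L f c\<close> is infinite.\<close>
  then obtain \<delta> where \<delta>: "sup_norm u < ereal \<delta>"
    and ratio: "\<And>v. v \<noteq> 0 \<Longrightarrow> \<bar>v\<bar> < \<delta> \<Longrightarrow> f v / v > c ^ 4 / 4"
    unfolding L_def not_le less_Sup_iff by auto
  have "\<bar>u t\<bar> < \<delta>" for t
  proof -
    have "ereal \<bar>u t\<bar> \<le> sup_norm u"
      unfolding sup_norm_def by (rule SUP_upper) simp
    from le_less_trans[OF this \<delta>] show ?thesis by simp
  qed
  with ratio have ratio_u: "f (u t) / u t > c ^ 4 / 4" if "u t \<noteq> 0" for t
    using that by blast
  have C4: "C4_on_reals u"
    and ode: "\<And>t. (deriv ^^ 4) u t + c\<^sup>2 * (deriv ^^ 2) u t + f (u t) = 0"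
    and lims: "(u \<longlongrightarrow> 0) at_top" "(u \<longlongrightarrow> 0) at_bot"
    using assms(7) by (auto simp: homoclinic_solution_def)
  have D: "((deriv ^^ k) u has_real_derivative (deriv ^^ Suc k) u t) (at t)" if "k < 4" for k t
    using C4 that by (auto simp: C4_on_reals_def DERIV_deriv_iff_real_differentiable)
  have cont: "isCont f 0"
    using assms(3) by (rule differentiable_imp_continuous_within)
  obtain s where "u s \<noteq> 0"
    using assms(8) by blast
  moreover have "u s = 0"
  proof (rule homoclinic_eq_0[OF _ _ _ _ lims cont isCont_sign_imp_zero[OF cont assms(2)] ratio_u])
    show "(u has_real_derivative (deriv ^^ 1) u t) (at t)" for t
      using D[of 0 t] by simp
    show "((deriv ^^ 1) u has_real_derivative (deriv ^^ 2) u t) (at t)" for t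
      using D[of 1 t] by (simp add: numeral_2_eq_2)
    show "((deriv ^^ 2) u has_real_derivative (deriv ^^ 3) u t) (at t)" for t
      using D[of 2 t] by (simp add: numeral_eq_Suc)
    have "(deriv ^^ 4) u t = - c\<^sup>2 * (deriv ^^ 2) u t - f (u t)" for t
      using ode[of t] by linarith
    then show "((deriv ^^ 3) u has_real_derivative - c\<^sup>2 * (deriv ^^ 2) u t - f (u t)) (at t)" for t
      using D[of 3 t] by (simp add: numeral_eq_Suc)
  qed
  ultimately show False by blast
qed

end
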